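(* Let $f\colon P\to Q$ and $g\colon Q'\to Q$ be surjective quandle homomorphisms, let $P'=P\times_Q Q'$ be their pullback, and let $g'\colon P'\to P$ and $f'\colon P'\to Q'$ be the projections. Then $f'$ is connected if and only if $\ker(\delta_{f,g})$ acts transitively on every fiber of $f$.
   Context: A quandle is a set $Q$ with bijections $s_x\colon Q\to Q$ ($x\in Q$) such that $s_x(x)=x$ and $s_x\circ s_y=s_{s_x(y)}\circ s_x$ for all $x,y\in Q$. A quandle homomorphism $f\colon P\to Q$ is a map with $f(s_x(y))=s_{f(x)}(f(y))$ for all $x,y\in P$. The inner automorphism group $\mathrm{Inn}(P)$ is the group of permutations of $P$ generated by all $s_x$, $x\in P$. A surjective quandle homomorphism $f\colon P\to Q$ induces a surjective group homomorphism $f_*\colon\mathrm{Inn}(P)\to\mathrm{Inn}(Q)$, where $f_*(\varphi)$ is the unique element of $\mathrm{Inn}(Q)$ with $f\circ\varphi=f_*(\varphi)\circ f$. Put $\mathrm{Inn}_{\mathrm{rel}}(f)=\ker(f_* )$; it preserves each fiber of $f$. The homomorphism $f$ is connected if it is surjective and for each $q\in Q$ the group $\mathrm{Inn}_{\mathrm{rel}}(f)$ acts transitively on $f^{-1}(q)$. The pullback $P\times_Q Q'=\{(x,q')\in P\times Q'\mid f(x)=g(q')\}$ carries the componentwise quandle structure. The group homomorphism $\delta_{f,g}\colon\mathrm{Inn}_{\mathrm{rel}}(f)\to\mathrm{Inn}_{\mathrm{rel}}(g)/f'_*(\mathrm{Inn}_{\mathrm{rel}}(g'))$ sends $\varphi$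 to the class of $f'_*(\tilde\varphi)$, where $\tilde\varphi\in\mathrm{Inn}(P')$ is any element with $g'_*(\tilde\varphi)=\varphi$; it fits into an exact sequence $1\to\mathrm{Inn}_{\mathrm{rel}}(f')\xrightarrow{g'_*}\mathrm{Inn}_{\mathrm{rel}}(f)\xrightarrow{\delta_{f,g}}\mathrm{Inn}_{\mathrm{rel}}(g)/f'_*(\mathrm{Inn}_{\mathrm{rel}}(g'))\to1$. *)

theory Defs
  imports "HOL-Algebra.Group_Action" "HOL-Algebra.Generated_Groups"
begin

text \<open>Only the values \<open>sym_at Q x y\<close> with \<open>x, y \<in> carrier Q\<close> are relevant; they represent \<open>s\<^sub>x(y)\<close>.\<close>

record 'a quandle_data = "'a partial_object" +
  sym_at :: "'a \<Rightarrow> 'a \<Rightarrow> 'a"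

locale quandle =
  fixes Q :: "('a, 'm) quandle_data_scheme"
  assumes bij_sym: "x \<in> carrier Q \<Longrightarrow> bij_betw (sym_at Q x) (carrier Q) (carrier Q)"
    and idem: "x \<in> carrier Q \<Longrightarrow> sym_at Q x x = x"
    and distrib: "\<lbrakk>x \<in> carrier Q; y \<in> carrier Q; z \<in> carrier Q\<rbrakk> \<Longrightarrow>
      sym_at Q x (sym_at Q y z) = sym_at Q (sym_at Q x y) (sym_at Q x z)"

locale quandle_hom = P: quandle P + Q: quandle Q
  for P :: "('a, 'm) quandle_data_scheme" and Q :: "('b, 'n) quandle_data_scheme" +
  fixes f :: "'a \<Rightarrow> 'b"
  assumes maps_to: "f \<in> carrier P \<rightarrow> carrier Q"
    and hom: "\<lbrakk>x \<in> carrier P; y \<in> carrier P\<rbrakk> \<Longrightarrow> f (sym_at P x y) = sym_at Q (f x) (f y)"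

locale surj_quandle_hom = quandle_hom +
  assumes surj: "f ` carrier P = carrier Q"

text \<open>Elements of \<open>BijGroup\<close> are extensional functions, hence the restriction of \<open>s\<^sub>x\<close>.\<close>

definition Inn :: "('a, 'm) quandle_data_scheme \<Rightarrow> ('a \<Rightarrow> 'a) monoid" where
  "Inn P = subgroup_generated (BijGroup (carrier P))
     ((\<lambda>x. restrict (sym_at P x) (carrier P)) ` carrier P)"

text \<open>The induced map \<open>f\<^sub>*\<close>; the description is proper when \<open>f\<close> is a surjective homomorphism
  and \<open>\<phi>\<close> is an inner automorphism.\<close>

definition induced :: "('a, 'm) quandle_data_scheme \<Rightarrow> ('b, 'n) quandle_data_scheme \<Rightarrow>
    ('a \<Rightarrow> 'b) \<Rightarrow> ('a \<Rightarrow> 'a) \<Rightarrow> ('b \<Rightarrow> 'b)" where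
  "induced P Q f \<phi> =
     (THE \<psi>. \<psi> \<in> carrier (Inn Q) \<and> (\<forall>x\<in>carrier P. f (\<phi> x) = \<psi> (f x)))"

definition Inn_rel :: "('a, 'm) quandle_data_scheme \<Rightarrow> ('b, 'n) quandle_data_scheme \<Rightarrow>
    ('a \<Rightarrow> 'b) \<Rightarrow> ('a \<Rightarrow> 'a) monoid" where
  "Inn_rel P Q f = (Inn P)\<lparr>carrier := kernel (Inn P) (Inn Q) (induced P Q f)\<rparr>"

definition fiber :: "('a, 'm) quandle_data_scheme \<Rightarrow> ('a \<Rightarrow> 'b) \<Rightarrow> 'b \<Rightarrow> 'a set" where
  "fiber P f q = {x \<in> carrier P. f x = q}"

text \<open>\<open>G\<close> is a group of permutations preserving \<open>E\<close>; it acts on \<open>E\<close> by evaluation.\<close>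

definition acts_transitively_on :: "('a \<Rightarrow> 'a) monoid \<Rightarrow> 'a set \<Rightarrow> bool" where
  "acts_transitively_on G E \<longleftrightarrow> transitive_action G E (\<lambda>\<phi>. restrict \<phi> E)"

definition connected_quandle_hom :: "('a, 'm) quandle_data_scheme \<Rightarrow>
    ('b, 'n) quandle_data_scheme \<Rightarrow> ('a \<Rightarrow> 'b) \<Rightarrow> bool" where
  "connected_quandle_hom P Q f \<longleftrightarrow> surj_quandle_hom P Q f \<and>
     (\<forall>q\<in>carrier Q. acts_transitively_on (Inn_rel P Q f) (fiber P f q))"

definition pullback :: "('a, 'm) quandle_data_scheme \<Rightarrow> ('c, 'k) quandle_data_scheme \<Rightarrow>
    ('a \<Rightarrow> 'b) \<Rightarrow> ('c \<Rightarrow> 'b) \<Rightarrow> ('a \<times> 'c) quandle_data" where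
  "pullback P Q' f g =
     \<lparr>carrier = {(x, q'). x \<in> carrier P \<and> q' \<in> carrier Q' \<and> f x = g q'},
      sym_at = (\<lambda>(x, q') (y, r'). (sym_at P x y, sym_at Q' q' r'))\<rparr>"

text \<open>The subgroup \<open>f'\<^sub>*(Inn\<^sub>r\<^sub>e\<^sub>l(g'))\<close> of \<open>Inn\<^sub>r\<^sub>e\<^sub>l(g)\<close>, where the projections of the
  pullback are \<open>g' = fst\<close> and \<open>f' = snd\<close>.\<close>

definition delta_sub :: "('a, 'm) quandle_data_scheme \<Rightarrow> ('c, 'k) quandle_data_scheme \<Rightarrow>
    ('a \<Rightarrow> 'b) \<Rightarrow> ('c \<Rightarrow> 'b) \<Rightarrow> ('c \<Rightarrow> 'c) set" where
  "delta_sub P Q' f g =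
     (let P' = pullback P Q' f g in induced P' Q' snd ` carrier (Inn_rel P' P fst))"

definition delta_codomain :: "('a, 'm) quandle_data_scheme \<Rightarrow> ('b, 'n) quandle_data_scheme \<Rightarrow>
    ('c, 'k) quandle_data_scheme \<Rightarrow> ('a \<Rightarrow> 'b) \<Rightarrow> ('c \<Rightarrow> 'b) \<Rightarrow> ('c \<Rightarrow> 'c) set monoid" where
  "delta_codomain P Q Q' f g = Inn_rel Q' Q g Mod delta_sub P Q' f g"

text \<open>The class does not depend on the lift, since two lifts differ by an element of
  \<open>Inn\<^sub>r\<^sub>e\<^sub>l(g')\<close>.\<close>

definition delta :: "('a, 'm) quandle_data_scheme \<Rightarrow> ('b, 'n) quandle_data_scheme \<Rightarrow>
    ('c, 'k) quandle_data_scheme \<Rightarrow> ('a \<Rightarrow> 'b) \<Rightarrow> ('c \<Rightarrow> 'b) \<Rightarrow> ('a \<Rightarrow> 'a) \<Rightarrow> ('c \<Rightarrow> 'c) set" where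
  "delta P Q Q' f g \<phi> =
     (let P' = pullback P Q' f g;
          \<phi>' = (SOME \<phi>'. \<phi>' \<in> carrier (Inn P') \<and> induced P' P fst \<phi>' = \<phi>)
      in delta_sub P Q' f g #>\<^bsub>Inn_rel Q' Q g\<^esub> induced P' Q' snd \<phi>')"

definition ker_delta :: "('a, 'm) quandle_data_scheme \<Rightarrow> ('b, 'n) quandle_data_scheme \<Rightarrow>
    ('c, 'k) quandle_data_scheme \<Rightarrow> ('a \<Rightarrow> 'b) \<Rightarrow> ('c \<Rightarrow> 'b) \<Rightarrow> ('a \<Rightarrow> 'a) monoid" where
  "ker_delta P Q Q' f g = (Inn_rel P Q f)\<lparr>carrier :=
     kernel (Inn_rel P Q f) (delta_codomain P Q Q' f g) (delta P Q Q' f g)\<rparr>"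

end

theory Submission
  imports Defs
begin

text \<open>By exactness, the kernel of \<open>\<delta>\<close> is the image of \<open>Inn\<^sub>r\<^sub>e\<^sub>l(f')\<close> under \<open>g'\<^sub>*\<close>: if
  \<open>\<phi>'\<close> lifts \<open>\<phi>\<close> and \<open>f'\<^sub>*(\<phi>') = f'\<^sub>*(\<kappa>)\<close> with \<open>\<kappa>\<close> in the kernel of \<open>g'\<^sub>*\<close>,
  then \<open>\<phi>'\<kappa>\<^sup>-\<^sup>1\<close> is another lift of \<open>\<phi>\<close> and lies in the kernel of \<open>f'\<^sub>*\<close>. An element \<open>\<theta>\<close> of
  \<open>Inn\<^sub>r\<^sub>e\<^sub>l(f')\<close> acts by \<open>(x, q') \<mapsto> (g'\<^sub>*(\<theta>)(x), q')\<close>, so under the bijection between the fiber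
  of \<open>f'\<close> over \<open>q'\<close> and the fiber of \<open>f\<close> over \<open>g(q')\<close> the actions of \<open>Inn\<^sub>r\<^sub>e\<^sub>l(f')\<close> and
  \<open>ker \<delta>\<close> have the same orbits. Every point of \<open>Q\<close> is some \<open>g(q')\<close>.\<close>

section \<open>Permutation groups and transitivity on invariant subsets\<close>

lemma carrier_BijGroup [simp]: "carrier (BijGroup S) = Bij S"
  by (simp add: BijGroup_def)

lemma one_BijGroup: "\<one>\<^bsub>BijGroup S\<^esub> = (\<lambda>x\<in>S. x)"
  by (simp add: BijGroup_def)

lemma mult_BijGroup_apply:
  assumes "\<phi> \<in> Bij S" "\<psi> \<in> Bij S" "x \<in> S"
  shows "(\<phi> \<otimes>\<^bsub>BijGroup S\<^esub> \<psi>) x = \<phi> (\<psi> x)"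
  using assms by (simp add: BijGroup_def compose_def)

lemma Bij_closed: "\<phi> \<in> Bij S \<Longrightarrow> x \<in> S \<Longrightarrow> \<phi> x \<in> S"
  using Bij_imp_funcset by blast

lemma inv_BijGroup_apply:
  assumes "\<phi> \<in> Bij S" "x \<in> S"
  shows "(inv\<^bsub>BijGroup S\<^esub> \<phi>) x \<in> S" "\<phi> ((inv\<^bsub>BijGroup S\<^esub> \<phi>) x) = x"
    "(inv\<^bsub>BijGroup S\<^esub> \<phi>) (\<phi> x) = x"
  using assms
  by (auto simp: inv_BijGroup Bij_inv_into_mem Bij_closed Bij_def bij_betw_inv_into_right
      bij_betw_inv_into_left)

text \<open>A subgroup contains inverses, so mapping \<open>E\<close> into itself already makes each
  element restrict to a bijection of \<open>E\<close>. Restriction is then a group action, and of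
  \<open>transitive_action\<close> only the orbit condition remains.\<close>

lemma acts_transitively_on_iff:
  assumes H: "subgroup H (BijGroup S)" and "E \<subseteq> S"
    and pres: "\<And>\<phi> x. \<phi> \<in> H \<Longrightarrow> x \<in> E \<Longrightarrow> \<phi> x \<in> E"
  shows "acts_transitively_on (BijGroup S\<lparr>carrier := H\<rparr>) E \<longleftrightarrow>
    (\<forall>x\<in>E. \<forall>y\<in>E. \<exists>\<phi>\<in>H. \<phi> x = y)"
proof -
  interpret B: group "BijGroup S" by (rule group_BijGroup)
  have HB: "\<phi> \<in> Bij S" if "\<phi> \<in> H" for \<phi>
    using subgroup.subset[OF H] that by auto
  have Bij: "restrict \<phi> E \<in> Bij E" if "\<phi> \<in> H" for \<phi>
  proof -
    have "inv\<^bsub>BijGroup S\<^esub> \<phi> \<in> H"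
      using H that by (rule subgroup.m_inv_closed)
    then have "bij_betw \<phi> E E"
      using that inv_BijGroup_apply(2,3)[OF HB[OF that] subsetD[OF \<open>E \<subseteq> S\<close>]]
      by (intro bij_betw_byWitness[where f' = "inv\<^bsub>BijGroup S\<^esub> \<phi>"]) (auto intro: pres)
    then show ?thesis
      by (simp add: Bij_def cong: bij_betw_cong)
  qed
  have "restrict (\<phi> \<otimes>\<^bsub>BijGroup S\<^esub> \<psi>) E = restrict \<phi> E \<otimes>\<^bsub>BijGroup E\<^esub> restrict \<psi> E"
    if "\<phi> \<in> H" "\<psi> \<in> H" for \<phi> \<psi>
  proof -
    \<comment> \<open>Outside \<open>E\<close> both sides are \<open>undefined\<close>, since
      \<open>compose\<close> in \<open>BijGroup E\<close> is itself restricted to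
      \<open>E\<close>.\<close>
    have "restrict (\<phi> \<otimes>\<^bsub>BijGroup S\<^esub> \<psi>) E x = (restrict \<phi> E \<otimes>\<^bsub>BijGroup E\<^esub> restrict \<psi> E) x" for x
      using that Bij[OF that(1)] Bij[OF that(2)] pres[OF that(2)] \<open>E \<subseteq> S\<close>
      by (cases "x \<in> E")
        (auto simp: mult_BijGroup_apply HB subsetD, auto simp: BijGroup_def compose_def)
    then show ?thesis by blast
  qed
  then have "group_action (BijGroup S\<lparr>carrier := H\<rparr>) E (\<lambda>\<phi>. restrict \<phi> E)"
    by (simp add: group_action_def group_hom_def group_hom_axioms_def hom_def group_BijGroup
        B.subgroup_imp_group[OF H] Bij)
  then show ?thesis
    by (auto simp: acts_transitively_on_def transitive_action_def transitive_action_axioms_def)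
qed

section \<open>Generators and elements of the inner automorphism group\<close>

definition inner_sym :: "('a, 'm) quandle_data_scheme \<Rightarrow> 'a \<Rightarrow> 'a \<Rightarrow> 'a" where
  "inner_sym P x = restrict (sym_at P x) (carrier P)"

lemma (in quandle) inner_sym_Bij: "x \<in> carrier Q \<Longrightarrow> inner_sym Q x \<in> Bij (carrier Q)"
  using bij_sym by (simp add: Bij_def inner_sym_def cong: bij_betw_cong)

text \<open>\<open>subgroup_generated\<close> intersects its generators with the carrier of the
  group; here this removes nothing, because each symmetry is a permutation. The form with
  \<open>generate\<close> gives induction over words in the symmetries.\<close>

lemma (in quandle) carrier_Inn:
  "carrier (Inn Q) = generate (BijGroup (carrier Q)) (inner_sym Q ` carrier Q)"
proof -
  have "Bij (carrier Q) \<inter> inner_sym Q ` carrier Q = inner_sym Q ` carrier Q"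
    using inner_sym_Bij by blast
  then show ?thesis
    by (simp add: Inn_def carrier_subgroup_generated inner_sym_def[abs_def])
qed

lemma Inn_eq: "Inn P = BijGroup (carrier P)\<lparr>carrier := carrier (Inn P)\<rparr>"
  by (simp add: Inn_def subgroup_generated_def)

lemma one_Inn: "\<one>\<^bsub>Inn P\<^esub> = (\<lambda>x\<in>carrier P. x)"
  by (subst Inn_eq) (simp add: one_BijGroup)

lemma mult_Inn: "mult (Inn P) = mult (BijGroup (carrier P))"
  by (subst Inn_eq) simp

lemma subgroup_Inn: "subgroup (carrier (Inn P)) (BijGroup (carrier P))"
  unfolding Inn_def
  by (rule group.subgroup_subgroup_generated) (rule group_BijGroup)

lemma group_Inn: "group (Inn P)"
  unfolding Inn_def by (rule group.group_subgroup_generated) (rule group_BijGroup)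

lemma Inn_Bij: "\<phi> \<in> carrier (Inn P) \<Longrightarrow> \<phi> \<in> Bij (carrier P)"
  using subgroup.subset[OF subgroup_Inn] by auto

lemma Inn_closed: "\<phi> \<in> carrier (Inn P) \<Longrightarrow> x \<in> carrier P \<Longrightarrow> \<phi> x \<in> carrier P"
  by (rule Bij_closed[OF Inn_Bij])

lemma mult_Inn_apply:
  assumes "\<phi> \<in> carrier (Inn P)" "\<psi> \<in> carrier (Inn P)" "x \<in> carrier P"
  shows "(\<phi> \<otimes>\<^bsub>Inn P\<^esub> \<psi>) x = \<phi> (\<psi> x)"
  using assms by (simp add: mult_Inn mult_BijGroup_apply Inn_Bij)

lemma Inn_eqI:
  assumes "\<phi> \<in> carrier (Inn P)" "\<psi> \<in> carrier (Inn P)"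
    and "\<And>x. x \<in> carrier P \<Longrightarrow> \<phi> x = \<psi> x"
  shows "\<phi> = \<psi>"
  using assms by (meson Bij_imp_extensional Inn_Bij extensionalityI)

lemma (in quandle) generate_inner_sym_Bij:
  "\<phi> \<in> generate (BijGroup (carrier Q)) (inner_sym Q ` carrier Q) \<Longrightarrow> \<phi> \<in> Bij (carrier Q)"
  using Inn_Bij carrier_Inn by blast

section \<open>Permutations compatible with a map\<close>

text \<open>A relation between \<phi> and \<psi>, so that compatibility can be carried along
  generators before \<psi> is known to be a function of \<phi>.\<close>

definition intertwines :: "'a set \<Rightarrow> ('a \<Rightarrow> 'b) \<Rightarrow> ('a \<Rightarrow> 'a) \<Rightarrow> ('b \<Rightarrow> 'b) \<Rightarrow> bool" where
  "intertwines S f \<phi> \<psi> \<longleftrightarrow> (\<forall>x\<in>S. f (\<phi> x) = \<psi> (f x))"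

context
  fixes S :: "'a set" and T :: "'b set" and f :: "'a \<Rightarrow> 'b"
  assumes f: "f \<in> S \<rightarrow> T"
begin

lemma intertwines_one: "intertwines S f \<one>\<^bsub>BijGroup S\<^esub> \<one>\<^bsub>BijGroup T\<^esub>"
  using f by (auto simp: intertwines_def one_BijGroup)

lemma intertwines_mult:
  assumes "\<phi> \<in> Bij S" "\<phi>' \<in> Bij S" "\<psi> \<in> Bij T" "\<psi>' \<in> Bij T"
    and "intertwines S f \<phi> \<psi>" "intertwines S f \<phi>' \<psi>'"
  shows "intertwines S f (\<phi> \<otimes>\<^bsub>BijGroup S\<^esub> \<phi>') (\<psi> \<otimes>\<^bsub>BijGroup T\<^esub> \<psi>')"
  using assms f
  by (simp add: intertwines_def mult_BijGroup_apply Bij_closed funcset_mem)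

text \<open>Evaluate the given relation at the preimage of \<open>x\<close> under \<phi> and cancel
  \<psi>.\<close>

lemma intertwines_inv:
  assumes "\<phi> \<in> Bij S" "\<psi> \<in> Bij T" and "intertwines S f \<phi> \<psi>"
  shows "intertwines S f (inv\<^bsub>BijGroup S\<^esub> \<phi>) (inv\<^bsub>BijGroup T\<^esub> \<psi>)"
  unfolding intertwines_def
proof
  fix x assume x: "x \<in> S"
  let ?y = "(inv\<^bsub>BijGroup S\<^esub> \<phi>) x"
  have y: "?y \<in> S" "\<phi> ?y = x"
    using inv_BijGroup_apply[OF assms(1) x] by auto
  then have "f x = \<psi> (f ?y)"
    using assms(3) by (metis intertwines_def)
  moreover have "f ?y \<in> T" using f y by auto
  ultimately show "f ?y = (inv\<^bsub>BijGroup T\<^esub> \<psi>) (f x)"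
    using inv_BijGroup_apply(3)[OF assms(2)] by simp
qed

end

section \<open>The homomorphism induced by a surjection, and its kernel\<close>

context surj_quandle_hom
begin

lemma intertwines_inner_sym:
  "x \<in> carrier P \<Longrightarrow> intertwines (carrier P) f (inner_sym P x) (inner_sym Q (f x))"
  using maps_to by (auto simp: intertwines_def inner_sym_def hom)

text \<open>Compatible pairs are closed under the group operations and include the symmetry at
  \<open>x\<close> paired with the symmetry at \<open>f x\<close>. A word in symmetries of
  \<open>P\<close> is thus matched by the corresponding word in \<open>Q\<close>.\<close>

lemma Inn_descends:
  assumes "\<phi> \<in> carrier (Inn P)"
  shows "\<exists>\<psi>\<in>carrier (Inn Q). intertwines (carrier P) f \<phi> \<psi>"
proof -
  show ?thesis
    using assms unfolding P.carrier_Inn Q.carrier_Inn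
  proof (induction rule: generate.induct)
    case one
    show ?case using intertwines_one[OF maps_to] generate.one by blast
  next
    case (incl h)
    then show ?case using intertwines_inner_sym maps_to by (blast intro: generate.incl)
  next
    case (inv h)
    then show ?case
      using intertwines_inner_sym maps_to intertwines_inv[OF maps_to]
        P.inner_sym_Bij Q.inner_sym_Bij by (blast intro: generate.inv)
  next
    case (eng h h')
    then show ?case
      using intertwines_mult[OF maps_to] P.generate_inner_sym_Bij Q.generate_inner_sym_Bij by (blast intro: generate.eng)
  qed
qed

text \<open>The same induction over words in \<open>Q\<close>; as \<open>f\<close> is onto, each
  generator is the symmetry at some \<open>f x\<close> and lifts to the symmetry at
  \<open>x\<close>.\<close>

lemma Inn_lifts:
  assumes "\<psi> \<in> carrier (Inn Q)"
  shows "\<exists>\<phi>\<in>carrier (Inn P). intertwines (carrier P) f \<phi> \<psi>"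
proof -
  show ?thesis
    using assms unfolding P.carrier_Inn Q.carrier_Inn
  proof (induction rule: generate.induct)
    case one
    show ?case using intertwines_one[OF maps_to] generate.one by blast
  next
    case (incl h)
    then obtain x where x: "x \<in> carrier P" "h = inner_sym Q (f x)"
      unfolding surj[symmetric] by blast
    then have "inner_sym P x \<in> generate (BijGroup (carrier P)) (inner_sym P ` carrier P)"
      by (simp add: generate.incl)
    then show ?case using intertwines_inner_sym x by blast
  next
    case (inv h)
    then obtain x where x: "x \<in> carrier P" "h = inner_sym Q (f x)"
      unfolding surj[symmetric] by blast
    then have "inv\<^bsub>BijGroup (carrier P)\<^esub> inner_sym P x
        \<in> generate (BijGroup (carrier P)) (inner_sym P ` carrier P)"
      by (simp add: generate.inv)
    moreover have "intertwines (carrier P) f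
        (inv\<^bsub>BijGroup (carrier P)\<^esub> inner_sym P x) (inv\<^bsub>BijGroup (carrier Q)\<^esub> h)"
      unfolding x(2) using x(1) funcset_mem[OF maps_to x(1)]
      by (intro intertwines_inv[OF maps_to] P.inner_sym_Bij Q.inner_sym_Bij intertwines_inner_sym)
    ultimately show ?case by blast
  next
    case (eng h h')
    then show ?case
      using intertwines_mult[OF maps_to] P.generate_inner_sym_Bij Q.generate_inner_sym_Bij by (blast intro: generate.eng)
  qed
qed

text \<open>The condition fixes \<psi> on the image of \<open>f\<close>, which is all of
  \<open>Q\<close>, so the definite description has at most one solution and any candidate is the
  induced map.\<close>

lemma induced_eqI:
  assumes "\<psi> \<in> carrier (Inn Q)" "\<And>x. x \<in> carrier P \<Longrightarrow> f (\<phi> x) = \<psi> (f x)"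
  shows "induced P Q f \<phi> = \<psi>"
  unfolding induced_def
proof (rule the_equality)
  fix \<psi>' assume *: "\<psi>' \<in> carrier (Inn Q) \<and> (\<forall>x\<in>carrier P. f (\<phi> x) = \<psi>' (f x))"
  then have "\<psi>' y = \<psi> y" if "y \<in> carrier Q" for y
    using that assms(2) surj by (metis imageE)
  then show "\<psi>' = \<psi>" using * assms(1) by (blast intro: Inn_eqI)
qed (use assms in auto)

lemma
  assumes "\<phi> \<in> carrier (Inn P)"
  shows induced_closed: "induced P Q f \<phi> \<in> carrier (Inn Q)"
    and induced_apply: "x \<in> carrier P \<Longrightarrow> induced P Q f \<phi> (f x) = f (\<phi> x)"
  using Inn_descends[OF assms] induced_eqI unfolding intertwines_def by metis+

lemma group_hom_induced: "group_hom (Inn P) (Inn Q) (induced P Q f)"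
proof -
  have "induced P Q f (\<phi> \<otimes>\<^bsub>Inn P\<^esub> \<psi>) = induced P Q f \<phi> \<otimes>\<^bsub>Inn Q\<^esub> induced P Q f \<psi>"
    if "\<phi> \<in> carrier (Inn P)" "\<psi> \<in> carrier (Inn P)" for \<phi> \<psi>
  proof (rule induced_eqI)
    show "induced P Q f \<phi> \<otimes>\<^bsub>Inn Q\<^esub> induced P Q f \<psi> \<in> carrier (Inn Q)"
      using that by (intro monoid.m_closed[OF group.is_monoid[OF group_Inn]] induced_closed)
    show "f ((\<phi> \<otimes>\<^bsub>Inn P\<^esub> \<psi>) x) = (induced P Q f \<phi> \<otimes>\<^bsub>Inn Q\<^esub> induced P Q f \<psi>) (f x)"
      if "x \<in> carrier P" for x
      using that \<open>\<phi> \<in> _\<close> \<open>\<psi> \<in> _\<close> funcset_mem[OF maps_to that]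
      by (simp add: mult_Inn_apply induced_closed induced_apply Inn_closed)
  qed
  then show ?thesis
    by (simp add: group_hom_def group_hom_axioms_def hom_def group_Inn induced_closed)
qed

lemma induced_surj:
  assumes "\<psi> \<in> carrier (Inn Q)"
  obtains \<phi> where "\<phi> \<in> carrier (Inn P)" "induced P Q f \<phi> = \<psi>"
  using Inn_lifts[OF assms] induced_eqI[OF assms] unfolding intertwines_def by metis

text \<open>If \<phi> stays within the fibers, the identity is a candidate for the induced map,
  hence equal to it; the converse is evaluation at \<open>f x\<close>.\<close>

lemma Inn_rel_iff:
  "\<phi> \<in> carrier (Inn_rel P Q f) \<longleftrightarrow>
    \<phi> \<in> carrier (Inn P) \<and> (\<forall>x\<in>carrier P. f (\<phi> x) = f x)"
proof -
  have "induced P Q f \<phi> = (\<lambda>x\<in>carrier Q. x) \<longleftrightarrow> (\<forall>x\<in>carrier P. f (\<phi> x) = f x)"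
    if "\<phi> \<in> carrier (Inn P)"
  proof
    assume "induced P Q f \<phi> = (\<lambda>x\<in>carrier Q. x)"
    then show "\<forall>x\<in>carrier P. f (\<phi> x) = f x"
      using induced_apply[OF that] maps_to by (metis funcset_mem restrict_apply')
  next
    assume "\<forall>x\<in>carrier P. f (\<phi> x) = f x"
    then show "induced P Q f \<phi> = (\<lambda>x\<in>carrier Q. x)"
      using maps_to group.is_monoid[OF group_Inn, THEN monoid.one_closed, of Q]
      by (intro induced_eqI) (auto simp: one_Inn)
  qed
  then show ?thesis by (auto simp: Inn_rel_def kernel_def one_Inn)
qed

lemma subgroup_Inn_rel: "subgroup (carrier (Inn_rel P Q f)) (Inn P)"
  using group_hom.subgroup_kernel[OF group_hom_induced] by (simp add: Inn_rel_def)

lemma subgroup_Inn_imp_BijGroup: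
  assumes "subgroup H (Inn P)"
  shows "subgroup H (BijGroup (carrier P))"
  using assms group.incl_subgroup[OF group_BijGroup subgroup_Inn] Inn_eq by metis

text \<open>Elements of \<open>Inn_rel P Q f\<close> preserve every fiber, which is the invariance
  that the orbit criterion asks for. A general \<open>H\<close> covers both the whole relative group
  and the kernel of \<open>delta\<close>.\<close>

lemma acts_transitively_on_fiber_iff:
  assumes "subgroup H (Inn P)" "H \<subseteq> carrier (Inn_rel P Q f)"
  shows "acts_transitively_on (Inn P\<lparr>carrier := H\<rparr>) (fiber P f q) \<longleftrightarrow>
    (\<forall>x\<in>fiber P f q. \<forall>y\<in>fiber P f q. \<exists>\<phi>\<in>H. \<phi> x = y)"
proof -
  have "Inn P\<lparr>carrier := H\<rparr> = BijGroup (carrier P)\<lparr>carrier := H\<rparr>"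
    by (subst Inn_eq) simp
  moreover have "\<phi> x \<in> fiber P f q" if "\<phi> \<in> H" "x \<in> fiber P f q" for \<phi> x
    using that assms(2) by (auto simp: fiber_def Inn_rel_iff subset_iff intro: Inn_closed)
  ultimately show ?thesis
    using acts_transitively_on_iff[OF subgroup_Inn_imp_BijGroup[OF assms(1)], of "fiber P f q"]
    by (auto simp: fiber_def)
qed

lemma connected_iff:
  "connected_quandle_hom P Q f \<longleftrightarrow>
    (\<forall>q\<in>carrier Q. \<forall>x\<in>fiber P f q. \<forall>y\<in>fiber P f q. \<exists>\<phi>\<in>carrier (Inn_rel P Q f). \<phi> x = y)"
proof -
  have "Inn_rel P Q f = Inn P\<lparr>carrier := carrier (Inn_rel P Q f)\<rparr>"
    by (simp add: Inn_rel_def)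
  then show ?thesis
    unfolding connected_quandle_hom_def
    using acts_transitively_on_fiber_iff[OF subgroup_Inn_rel] surj_quandle_hom_axioms by auto
qed

end

section \<open>The pullback and its projections\<close>

locale quandle_pullback = f: surj_quandle_hom P Q f + g: surj_quandle_hom Q' Q g
  for P :: "('a, 'm) quandle_data_scheme"
    and Q :: "('b, 'n) quandle_data_scheme"
    and Q' :: "('c, 'k) quandle_data_scheme"
    and f :: "'a \<Rightarrow> 'b" and g :: "'c \<Rightarrow> 'b"
begin

abbreviation P' where "P' \<equiv> pullback P Q' f g"

lemma carrier_pullback:
  "carrier P' = {(x, q'). x \<in> carrier P \<and> q' \<in> carrier Q' \<and> f x = g q'}"
  by (simp add: pullback_def)

lemma sym_at_pullback [simp]:
  "sym_at P' (x, q') (y, r') = (sym_at P x y, sym_at Q' q' r')"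
  by (simp add: pullback_def)

lemma quandle_pullback: "quandle P'"
proof
  fix p assume "p \<in> carrier P'"
  then obtain x q where p: "p = (x, q)" "x \<in> carrier P" "q \<in> carrier Q'" "f x = g q"
    by (auto simp: carrier_pullback)
  show "sym_at P' p p = p"
    using p f.P.idem g.P.idem by simp
  have bij: "bij_betw (sym_at P x) (carrier P) (carrier P)"
    "bij_betw (sym_at Q' q) (carrier Q') (carrier Q')"
    "bij_betw (sym_at Q (f x)) (carrier Q) (carrier Q)"
    using p f.P.bij_sym g.P.bij_sym f.Q.bij_sym funcset_mem[OF f.maps_to] by blast+
  have "inj_on (sym_at P' p) (carrier P')"
    using bij(1,2) by (auto simp: inj_on_def carrier_pullback p(1) bij_betw_def)
  moreover have "sym_at P' p ` carrier P' = carrier P'"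
  proof (intro equalityI subsetI)
    fix r assume "r \<in> sym_at P' p ` carrier P'"
    then obtain y s where "r = (sym_at P x y, sym_at Q' q s)" "y \<in> carrier P" "s \<in> carrier Q'"
      "f y = g s"
      by (auto simp: carrier_pullback p(1))
    then show "r \<in> carrier P'"
      using bij(1,2) p by (auto simp: carrier_pullback f.hom g.hom bij_betw_apply)
  next
    fix r assume "r \<in> carrier P'"
    then obtain y s where r: "r = (y, s)" "y \<in> carrier P" "s \<in> carrier Q'" "f y = g s"
      by (auto simp: carrier_pullback)
    then have "y \<in> sym_at P x ` carrier P" "s \<in> sym_at Q' q ` carrier Q'"
      using bij(1,2)[THEN bij_betw_imp_surj_on] by simp_all
    then obtain y' s' where ys: "y' \<in> carrier P" "sym_at P x y' = y"
      "s' \<in> carrier Q'" "sym_at Q' q s' = s"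
      by blast
    \<comment> \<open>The preimages were chosen separately in \<open>P\<close> and
      \<open>Q'\<close>. They form a point of the pullback because the symmetry of \<open>Q\<close>
      at \<open>f x = g q\<close> is injective and sends \<open>f y'\<close> and \<open>g s'\<close>
      to the same point.\<close>
    then have "sym_at Q (f x) (f y') = sym_at Q (f x) (g s')"
      using r p f.hom g.hom by metis
    then have "f y' = g s'"
      using bij(3) ys f.maps_to g.maps_to by (auto simp: bij_betw_def dest!: inj_onD)
    then show "r \<in> sym_at P' p ` carrier P'"
      using ys r p by (auto simp: carrier_pullback intro!: image_eqI[of _ _ "(y', s')"])
  qed
  ultimately show "bij_betw (sym_at P' p) (carrier P') (carrier P')"
    by (simp add: bij_betw_def)
next
  fix p r t assume "p \<in> carrier P'" "r \<in> carrier P'" "t \<in> carrier P'"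
  then show "sym_at P' p (sym_at P' r t) = sym_at P' (sym_at P' p r) (sym_at P' p t)"
    by (auto simp: carrier_pullback f.P.distrib g.P.distrib)
qed

lemma surj_fst: "surj_quandle_hom P' P fst"
proof -
  interpret P': quandle P' by (rule quandle_pullback)
  show ?thesis
  proof
    show "fst ` carrier P' = carrier P"
    proof (intro equalityI subsetI)
      fix x assume "x \<in> carrier P"
      then have "f x \<in> g ` carrier Q'" using f.maps_to g.surj by auto
      with \<open>x \<in> carrier P\<close> show "x \<in> fst ` carrier P'"
        by (force simp: carrier_pullback)
    qed (auto simp: carrier_pullback)
  qed (auto simp: carrier_pullback)
qed

lemma surj_snd: "surj_quandle_hom P' Q' snd"
proof -
  interpret P': quandle P' by (rule quandle_pullback)
  show ?thesis
  proof
    show "snd ` carrier P' = carrier Q'"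
    proof (intro equalityI subsetI)
      fix x assume "x \<in> carrier Q'"
      then have "g x \<in> f ` carrier P" using g.maps_to f.surj by auto
      with \<open>x \<in> carrier Q'\<close> show "x \<in> snd ` carrier P'"
        by (force simp: carrier_pullback)
    qed (auto simp: carrier_pullback)
  qed (auto simp: carrier_pullback)
qed

sublocale fst: surj_quandle_hom P' P fst by (rule surj_fst)
sublocale snd: surj_quandle_hom P' Q' snd by (rule surj_snd)

text \<open>Each coordinate is the defining property of the map induced by a projection; an inner
  automorphism of the pullback is therefore determined by its two images.\<close>

lemma Inn_pullback_apply:
  assumes "\<theta> \<in> carrier (Inn P')" "(x, q) \<in> carrier P'"
  shows "\<theta> (x, q) = (induced P' P fst \<theta> x, induced P' Q' snd \<theta> q)"
  using fst.induced_apply[OF assms] snd.induced_apply[OF assms]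
  by (simp add: prod_eq_iff)

text \<open>The point \<theta>\<open>(x, q)\<close> lies in the pullback and still has second
  coordinate \<open>q\<close>, so \<open>f\<close> of its first coordinate is
  \<open>g q = f x\<close>.\<close>

lemma induced_fst_rel:
  assumes "\<theta> \<in> carrier (Inn_rel P' Q' snd)"
  shows "induced P' P fst \<theta> \<in> carrier (Inn_rel P Q f)"
proof -
  have \<theta>: "\<theta> \<in> carrier (Inn P')" "\<And>p. p \<in> carrier P' \<Longrightarrow> snd (\<theta> p) = snd p"
    using assms snd.Inn_rel_iff by auto
  have "f (induced P' P fst \<theta> x) = f x" if "x \<in> carrier P" for x
  proof -
    obtain q where q: "(x, q) \<in> carrier P'"
      using \<open>x \<in> carrier P\<close> unfolding fst.surj[symmetric] by force
    have "f (fst (\<theta> (x, q))) = g (snd (\<theta> (x, q)))"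
      using Inn_closed[OF \<theta>(1) q] by (auto simp: carrier_pullback)
    with q \<theta>(2)[OF q] fst.induced_apply[OF \<theta>(1) q] show ?thesis
      by (simp add: carrier_pullback)
  qed
  then show ?thesis
    using fst.induced_closed \<theta>(1) by (auto simp: f.Inn_rel_iff)
qed

text \<open>Again \<theta>\<open>(x, q)\<close> lies in the pullback, so \<open>g\<close> of its
  second coordinate is \<open>f\<close> of its first, which is \<open>f x = g q\<close>.\<close>

lemma induced_snd_rel:
  assumes "\<theta> \<in> carrier (Inn P')" "induced P' P fst \<theta> \<in> carrier (Inn_rel P Q f)"
  shows "induced P' Q' snd \<theta> \<in> carrier (Inn_rel Q' Q g)"
proof -
  have "g (induced P' Q' snd \<theta> q) = g q" if "q \<in> carrier Q'" for q
  proof -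
    obtain x where x: "(x, q) \<in> carrier P'"
      using \<open>q \<in> carrier Q'\<close> unfolding snd.surj[symmetric] by force
    then show ?thesis
      using assms Inn_closed[OF assms(1) x] Inn_pullback_apply[OF assms(1) x]
      by (auto simp: carrier_pullback f.Inn_rel_iff)
  qed
  then show ?thesis
    using snd.induced_closed assms(1) by (auto simp: g.Inn_rel_iff)
qed

section \<open>The kernel of \<open>delta\<close>\<close>

text \<open>Lets \<open>induced_snd_rel\<close> apply to elements with trivial image in
  \<open>Inn P\<close>, whose second images make up \<open>delta_sub\<close>.\<close>

lemma one_rel: "\<one>\<^bsub>Inn P\<^esub> \<in> carrier (Inn_rel P Q f)"
  by (rule subgroup.one_closed[OF f.subgroup_Inn_rel])

lemma delta_sub_eq: "delta_sub P Q' f g = induced P' Q' snd ` carrier (Inn_rel P' P fst)"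
  by (simp add: delta_sub_def Let_def)

lemma subgroup_delta_sub: "subgroup (delta_sub P Q' f g) (Inn_rel Q' Q g)"
proof -
  have "subgroup (delta_sub P Q' f g) (Inn Q')"
    unfolding delta_sub_eq
    by (rule group_hom.subgroup_img_is_subgroup[OF snd.group_hom_induced fst.subgroup_Inn_rel])
  moreover have "delta_sub P Q' f g \<subseteq> carrier (Inn_rel Q' Q g)"
    unfolding delta_sub_eq
    using induced_snd_rel one_rel by (auto simp: Inn_rel_def kernel_def)
  ultimately show ?thesis
    using group.subgroup_incl[OF group_Inn _ g.subgroup_Inn_rel] by (simp add: Inn_rel_def)
qed

text \<open>Exactness at \<open>Inn_rel P Q f\<close>: changing a lift of \<phi> by elements with
  trivial image in \<open>Inn P\<close> can make its image in \<open>Inn Q'\<close> trivial exactly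
  when that image lies in \<open>delta_sub\<close>.\<close>

lemma delta_trivial_iff:
  assumes "\<phi> \<in> carrier (Inn_rel P Q f)"
  shows "delta P Q Q' f g \<phi> = delta_sub P Q' f g \<longleftrightarrow>
    \<phi> \<in> induced P' P fst ` carrier (Inn_rel P' Q' snd)"
proof -
  interpret F: group_hom "Inn P'" "Inn P" "induced P' P fst" by (rule fst.group_hom_induced)
  interpret S: group_hom "Inn P'" "Inn Q'" "induced P' Q' snd" by (rule snd.group_hom_induced)
  \<comment> \<open>This is the term chosen inside \<open>delta\<close>; once \<open>delta\<close>
    is unfolded, it enters only as some lift of \<phi>.\<close>
  define \<phi>' where "\<phi>' = (SOME \<phi>'. \<phi>' \<in> carrier (Inn P') \<and> induced P' P fst \<phi>' = \<phi>)"
  have \<phi>: "\<phi> \<in> carrier (Inn P)" using assms by (simp add: f.Inn_rel_iff)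
  have "\<exists>\<phi>'. \<phi>' \<in> carrier (Inn P') \<and> induced P' P fst \<phi>' = \<phi>"
    using fst.induced_surj[OF \<phi>] by metis
  then have \<phi>': "\<phi>' \<in> carrier (Inn P')" "induced P' P fst \<phi>' = \<phi>"
    unfolding \<phi>'_def by (rule someI2_ex, simp)+
  have rel: "induced P' Q' snd \<phi>' \<in> carrier (Inn_rel Q' Q g)"
    using induced_snd_rel \<phi>' assms by simp
  have grp: "group (Inn_rel Q' Q g)"
    using group.subgroup_imp_group[OF group_Inn g.subgroup_Inn_rel] by (simp add: Inn_rel_def)
  \<comment> \<open>A right coset of a subgroup equals the subgroup exactly when its representative
    belongs to it.\<close>
  have "delta P Q Q' f g \<phi> = delta_sub P Q' f g \<longleftrightarrow>
      induced P' Q' snd \<phi>' \<in> delta_sub P Q' f g"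
    unfolding delta_def Let_def \<phi>'_def[symmetric]
    using group.coset_join1[OF grp _ rel subgroup_delta_sub]
      group.coset_join2[OF grp rel subgroup_delta_sub] by blast
  also have "\<dots> \<longleftrightarrow> \<phi> \<in> induced P' P fst ` carrier (Inn_rel P' Q' snd)"
  proof
    assume "induced P' Q' snd \<phi>' \<in> delta_sub P Q' f g"
    then obtain \<kappa> where \<kappa>: "\<kappa> \<in> carrier (Inn P')" "induced P' P fst \<kappa> = \<one>\<^bsub>Inn P\<^esub>"
      "induced P' Q' snd \<phi>' = induced P' Q' snd \<kappa>"
      by (auto simp: delta_sub_eq Inn_rel_def kernel_def)
    let ?\<theta> = "\<phi>' \<otimes>\<^bsub>Inn P'\<^esub> inv\<^bsub>Inn P'\<^esub> \<kappa>"
    have "?\<theta> \<in> carrier (Inn_rel P' Q' snd)"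
      using \<kappa> \<phi>' by (simp add: Inn_rel_def kernel_def)
    moreover have "induced P' P fst ?\<theta> = \<phi>"
      using \<kappa> \<phi>' \<phi> by simp
    ultimately show "\<phi> \<in> induced P' P fst ` carrier (Inn_rel P' Q' snd)" by (metis imageI)
  next
    assume "\<phi> \<in> induced P' P fst ` carrier (Inn_rel P' Q' snd)"
    then obtain \<theta> where \<theta>: "\<theta> \<in> carrier (Inn P')" "induced P' Q' snd \<theta> = \<one>\<^bsub>Inn Q'\<^esub>"
      "\<phi> = induced P' P fst \<theta>"
      by (auto simp: Inn_rel_def kernel_def)
    \<comment> \<open>Both factors lie over \<phi>, so the quotient is trivial in
      \<open>Inn P\<close>; since \<theta> is trivial in \<open>Inn Q'\<close>, the image of \<phi>'
      there is unchanged.\<close>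
    let ?\<kappa> = "\<phi>' \<otimes>\<^bsub>Inn P'\<^esub> inv\<^bsub>Inn P'\<^esub> \<theta>"
    have "?\<kappa> \<in> carrier (Inn_rel P' P fst)"
      using \<theta> \<phi>' \<phi> by (simp add: Inn_rel_def kernel_def)
    moreover have "induced P' Q' snd ?\<kappa> = induced P' Q' snd \<phi>'"
      using \<theta> \<phi>' by simp
    ultimately show "induced P' Q' snd \<phi>' \<in> delta_sub P Q' f g"
      unfolding delta_sub_eq by (metis imageI)
  qed
  finally show ?thesis .
qed

text \<open>The unit of the quotient group is \<open>delta_sub\<close> itself, so the triviality
  criterion describes the kernel; the image on the right consists of elements of
  \<open>Inn_rel P Q f\<close>, hence all of it is reached.\<close>

lemma ker_delta_eq:
  "ker_delta P Q Q' f g =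
    Inn P\<lparr>carrier := induced P' P fst ` carrier (Inn_rel P' Q' snd)\<rparr>"
proof -
  have "kernel (Inn_rel P Q f) (delta_codomain P Q Q' f g) (delta P Q Q' f g) =
      induced P' P fst ` carrier (Inn_rel P' Q' snd)"
    using delta_trivial_iff induced_fst_rel
    by (auto simp: kernel_def delta_codomain_def FactGroup_def)
  then show ?thesis by (simp add: ker_delta_def Inn_rel_def)
qed

lemma acts_transitively_on_ker_delta_iff:
  "acts_transitively_on (ker_delta P Q Q' f g) (fiber P f q) \<longleftrightarrow>
    (\<forall>x\<in>fiber P f q. \<forall>y\<in>fiber P f q.
      \<exists>\<theta>\<in>carrier (Inn_rel P' Q' snd). induced P' P fst \<theta> x = y)"
proof -
  have "subgroup (induced P' P fst ` carrier (Inn_rel P' Q' snd)) (Inn P)"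
    by (rule group_hom.subgroup_img_is_subgroup[OF fst.group_hom_induced snd.subgroup_Inn_rel])
  from f.acts_transitively_on_fiber_iff[OF this] show ?thesis
    using induced_fst_rel unfolding ker_delta_eq by (simp add: image_subset_iff)
qed

section \<open>Orbits on corresponding fibers\<close>

lemma fiber_snd:
  assumes "q' \<in> carrier Q'"
  shows "fiber P' snd q' = (\<lambda>x. (x, q')) ` fiber P f (g q')"
  using assms by (auto simp: fiber_def carrier_pullback)

text \<open>The second coordinate stays \<open>q'\<close> under \<open>Inn_rel P' Q' snd\<close>, so
  hitting a prescribed point of the fiber is an equation in the first coordinate alone.\<close>

lemma transitive_on_fiber_snd_iff:
  assumes "q' \<in> carrier Q'"
  shows "(\<forall>p\<in>fiber P' snd q'. \<forall>r\<in>fiber P' snd q'.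
      \<exists>\<theta>\<in>carrier (Inn_rel P' Q' snd). \<theta> p = r) \<longleftrightarrow>
    acts_transitively_on (ker_delta P Q Q' f g) (fiber P f (g q'))"
proof -
  have "\<theta> (x, q') = (y, q') \<longleftrightarrow> induced P' P fst \<theta> x = y"
    if "\<theta> \<in> carrier (Inn_rel P' Q' snd)" "x \<in> fiber P f (g q')" for \<theta> x y
  proof -
    have x: "(x, q') \<in> carrier P'"
      using that(2) assms by (simp add: fiber_def carrier_pullback)
    have \<theta>: "\<theta> \<in> carrier (Inn P')" "snd (\<theta> (x, q')) = q'"
      using that(1) x by (auto simp: snd.Inn_rel_iff)
    then show ?thesis
      using Inn_pullback_apply[OF \<theta>(1) x] by simp
  qed
  then show ?thesis
    unfolding acts_transitively_on_ker_delta_iff fiber_snd[OF assms] by auto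
qed

end

theorem corollary3p29:
  fixes P :: "('a, 'm) quandle_data_scheme"
    and Q :: "('b, 'n) quandle_data_scheme"
    and Q' :: "('c, 'k) quandle_data_scheme"
    and f :: "'a \<Rightarrow> 'b" and g :: "'c \<Rightarrow> 'b"
  assumes "surj_quandle_hom P Q f"
    and "surj_quandle_hom Q' Q g"
  shows "connected_quandle_hom (pullback P Q' f g) Q' snd \<longleftrightarrow>
    (\<forall>q\<in>carrier Q. acts_transitively_on (ker_delta P Q Q' f g) (fiber P f q))"
proof -
  interpret quandle_pullback P Q Q' f g
    using assms by (rule quandle_pullback.intro)
  \<comment> \<open>Writing \<open>carrier Q\<close> as the image of \<open>g\<close> turns the
    condition over points of \<open>Q\<close> into one over points \<open>q'\<close> of
    \<open>Q'\<close>, to be compared fiber by fiber.\<close>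
  show ?thesis
    unfolding snd.connected_iff by (simp add: transitive_on_fiber_snd_iff flip: g.surj)
qed

end
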